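(* Let $V=\frac{\partial}{\partial x^3}$ and $\eta=dx^3$, and let $\lambda,\mu$ be smooth functions on $I$ with $\mu$ not identically zero. If $f_1,f_2$ depend only on $x^2$, then $(I,\tilde g,V,\lambda,\mu)$ is an almost $\eta$-Ricci soliton if and only if $$\lambda=-f_2^2\left[\left(\frac{f_1'}{f_1}\right)'-\left(\frac{f_1'}{f_1}\right)^2+\frac{f_1'}{f_1}\frac{f_2'}{f_2}\right]\quad\text{and}\quad \mu=f_2^2\left[\left(\frac{f_1'}{f_1}\right)'-\left(\frac{f_1'}{f_1}\right)^2+\frac{f_1'}{f_1}\frac{f_2'}{f_2}\right].$$
   Context: Let $I=I_1\times I_2\times I_3\subseteq\mathbb R^3$ with $I_1,I_2,I_3\subseteq\mathbb R$ open intervals and standard coordinates $x^1,x^2,x^3$. Let $f_1,f_2$ be smooth nowhere zero functions on $I$ and endow $I$ with the Riemannian metric $\tilde g=\frac{1}{f_1^2}dx^1\otimes dx^1+\frac{1}{f_2^2}dx^2\otimes dx^2+dx^3\otimes dx^3$, with orthonormal frame $E_1=f_1\frac{\partial}{\partial x^1}$, $E_2=f_2\frac{\partial}{\partial x^2}$, $E_3=\frac{\partial}{\partial x^3}$. For a smooth vector field $V$, a $1$-form $\eta$, and smooth functions $\lambda,\mu$ on $I$ with $\mu\neq0$ (not identically zero), $(I,\tilde g,V,\lambda,\mu)$ is an almost $\eta$-Ricci soliton if $\frac12\pounds_V\tilde g+\mathrm{Ric}+\lambda\tilde g+\mu\,\eta\otimes\eta=0$ on $I$, where $\pounds_V\tilde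 g$ is the Lie derivative of $\tilde g$ along $V$ and $\mathrm{Ric}$ is the Ricci tensor of $\tilde g$, with $\mathrm{Ric}(Y,Z)=\sum_{k}\tilde g(R(E_k,Y)Z,E_k)$, $R(X,Y)Z=\nabla_X\nabla_YZ-\nabla_Y\nabla_XZ-\nabla_{[X,Y]}Z$, $\nabla$ the Levi-Civita connection. A prime denotes the derivative with respect to $x^2$. *)

theory Defs
  imports "HOL-Analysis.Analysis"
begin

(* Everything lives on an open subset S of a Euclidean space. Functions and fields are total on
   the ambient space, but only their values on S matter: as S is open, derivatives at points
   of S depend only on values on S. *)

type_synonym 'a scalar_field = "'a \<Rightarrow> real"
type_synonym 'a vector_field = "'a \<Rightarrow> 'a"
type_synonym 'a one_form = "'a \<Rightarrow> 'a \<Rightarrow> real"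
type_synonym 'a metric = "'a \<Rightarrow> 'a \<Rightarrow> 'a \<Rightarrow> real"
type_synonym 'a connection = "'a vector_field \<Rightarrow> 'a vector_field \<Rightarrow> 'a vector_field"

section \<open>Smoothness\<close>

primrec Ck_on :: "nat \<Rightarrow> 'a set \<Rightarrow> ('a::euclidean_space \<Rightarrow> 'b::real_normed_vector) \<Rightarrow> bool" where
  "Ck_on 0 S f \<longleftrightarrow> continuous_on S f"
| "Ck_on (Suc k) S f \<longleftrightarrow>
     f differentiable_on S \<and> (\<forall>v. Ck_on k S (\<lambda>x. frechet_derivative f (at x) v))"

definition smooth_on :: "'a set \<Rightarrow> ('a::euclidean_space \<Rightarrow> 'b::real_normed_vector) \<Rightarrow> bool" where
  "smooth_on S f \<longleftrightarrow> (\<forall>k. Ck_on k S f)"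

definition smooth_one_form_on :: "'a set \<Rightarrow> 'a::euclidean_space one_form \<Rightarrow> bool" where
  "smooth_one_form_on S \<eta> \<longleftrightarrow> (\<forall>x\<in>S. linear (\<eta> x)) \<and> (\<forall>v. smooth_on S (\<lambda>x. \<eta> x v))"

section \<open>Connections, curvature, Lie derivative\<close>

text \<open>The function \<open>X(f)\<close>; for a vector field \<open>F\<close> in place of \<open>f\<close> it is taken componentwise.\<close>

definition dir_deriv ::
  "'a vector_field \<Rightarrow> ('a::euclidean_space \<Rightarrow> 'b::real_normed_vector) \<Rightarrow> 'a \<Rightarrow> 'b" where
  "dir_deriv X f x = frechet_derivative f (at x) (X x)"

definition lie_bracket ::
  "'a::euclidean_space vector_field \<Rightarrow> 'a vector_field \<Rightarrow> 'a vector_field" where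
  "lie_bracket X Y x = dir_deriv X Y x - dir_deriv Y X x"

definition affine_connection_on :: "'a set \<Rightarrow> 'a::euclidean_space connection \<Rightarrow> bool" where
  "affine_connection_on S D \<longleftrightarrow>
     (\<forall>X Y. smooth_on S X \<longrightarrow> smooth_on S Y \<longrightarrow> smooth_on S (D X Y)) \<and>
     (\<forall>X Y Z. smooth_on S X \<longrightarrow> smooth_on S Y \<longrightarrow> smooth_on S Z \<longrightarrow>
        (\<forall>x\<in>S. D (\<lambda>y. X y + Y y) Z x = D X Z x + D Y Z x \<and>
               D X (\<lambda>y. Y y + Z y) x = D X Y x + D X Z x)) \<and>
     (\<forall>f X Y. smooth_on S f \<longrightarrow> smooth_on S X \<longrightarrow> smooth_on S Y \<longrightarrow>
        (\<forall>x\<in>S. D (\<lambda>y. f y *\<^sub>R X y) Y x = f x *\<^sub>R D X Y x \<and>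
               D X (\<lambda>y. f y *\<^sub>R Y y) x = dir_deriv X f x *\<^sub>R Y x + f x *\<^sub>R D X Y x))"

definition is_levi_civita_on ::
  "'a set \<Rightarrow> 'a::euclidean_space metric \<Rightarrow> 'a connection \<Rightarrow> bool" where
  "is_levi_civita_on S g D \<longleftrightarrow>
     affine_connection_on S D \<and>
     (\<forall>X Y. smooth_on S X \<longrightarrow> smooth_on S Y \<longrightarrow>
        (\<forall>x\<in>S. D X Y x - D Y X x = lie_bracket X Y x)) \<and>
     (\<forall>X Y Z. smooth_on S X \<longrightarrow> smooth_on S Y \<longrightarrow> smooth_on S Z \<longrightarrow>
        (\<forall>x\<in>S. dir_deriv X (\<lambda>y. g y (Y y) (Z y)) x
               = g x (D X Y x) (Z x) + g x (Y x) (D X Z x)))"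

text \<open>By the fundamental theorem of Riemannian geometry such a connection exists, and its values on
  \<open>S\<close> for fields smooth on \<open>S\<close> are unique. Only the irrelevant values (outside \<open>S\<close>, or on
  non-smooth arguments) depend on the choice made here; because of them \<open>THE\<close> cannot be used.\<close>

definition levi_civita :: "'a set \<Rightarrow> 'a::euclidean_space metric \<Rightarrow> 'a connection" where
  "levi_civita S g = (SOME D. is_levi_civita_on S g D)"

definition curvature ::
  "'a::euclidean_space connection \<Rightarrow>
     'a vector_field \<Rightarrow> 'a vector_field \<Rightarrow> 'a vector_field \<Rightarrow> 'a vector_field" where
  "curvature D X Y Z x = D X (D Y Z) x - D Y (D X Z) x - D (lie_bracket X Y) Z x"

text \<open>\<open>E\<close> is meant to be a \<open>g\<close>-orthonormal frame on \<open>S\<close>.\<close>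

definition ricci ::
  "'a set \<Rightarrow> 'a metric \<Rightarrow> ('k::finite \<Rightarrow> 'a vector_field) \<Rightarrow>
     'a vector_field \<Rightarrow> 'a vector_field \<Rightarrow> 'a::euclidean_space \<Rightarrow> real" where
  "ricci S g E Y Z x = (\<Sum>k\<in>UNIV. g x (curvature (levi_civita S g) (E k) Y Z x) (E k x))"

definition lie_deriv_metric ::
  "'a::euclidean_space vector_field \<Rightarrow> 'a metric \<Rightarrow>
     'a vector_field \<Rightarrow> 'a vector_field \<Rightarrow> 'a \<Rightarrow> real" where
  "lie_deriv_metric V g Y Z x =
     dir_deriv V (\<lambda>y. g y (Y y) (Z y)) x
     - g x (lie_bracket V Y x) (Z x) - g x (Y x) (lie_bracket V Z x)"

text \<open>The tensor equation is expressed by evaluating both sides on all pairs of smooth fields.\<close>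

definition almost_eta_ricci_soliton ::
  "'a set \<Rightarrow> 'a metric \<Rightarrow> ('k::finite \<Rightarrow> 'a vector_field) \<Rightarrow> 'a vector_field \<Rightarrow>
     'a one_form \<Rightarrow> 'a scalar_field \<Rightarrow> 'a::euclidean_space scalar_field \<Rightarrow> bool" where
  "almost_eta_ricci_soliton S g E V \<eta> lam mu \<longleftrightarrow>
     smooth_on S V \<and> smooth_one_form_on S \<eta> \<and> smooth_on S lam \<and> smooth_on S mu \<and>
     (\<exists>x\<in>S. mu x \<noteq> 0) \<and>
     (\<forall>Y Z. smooth_on S Y \<longrightarrow> smooth_on S Z \<longrightarrow>
        (\<forall>x\<in>S. 1 / 2 * lie_deriv_metric V g Y Z x + ricci S g E Y Z x
               + lam x * g x (Y x) (Z x) + mu x * (\<eta> x (Y x) * \<eta> x (Z x)) = 0))"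

section \<open>Coordinates and the metric on a box in three-space\<close>

definition coord_field :: "'n::finite \<Rightarrow> (real ^ 'n) vector_field" where
  "coord_field i x = axis i 1"

definition coord_form :: "'n::finite \<Rightarrow> (real ^ 'n) one_form" where
  "coord_form i x v = v $ i"

definition partial :: "'n::finite \<Rightarrow> (real ^ 'n) scalar_field \<Rightarrow> (real ^ 'n) scalar_field" where
  "partial i f = dir_deriv (coord_field i) f"

definition box3 :: "real set \<Rightarrow> real set \<Rightarrow> real set \<Rightarrow> (real ^ 3) set" where
  "box3 I1 I2 I3 = {x. x $ 1 \<in> I1 \<and> x $ 2 \<in> I2 \<and> x $ 3 \<in> I3}"

definition g_tilde :: "(real ^ 3) scalar_field \<Rightarrow> (real ^ 3) scalar_field \<Rightarrow> (real ^ 3) metric" where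
  "g_tilde f1 f2 x v w =
     1 / (f1 x)\<^sup>2 * (coord_form 1 x v * coord_form 1 x w)
     + 1 / (f2 x)\<^sup>2 * (coord_form 2 x v * coord_form 2 x w)
     + coord_form 3 x v * coord_form 3 x w"

definition frame ::
  "(real ^ 3) scalar_field \<Rightarrow> (real ^ 3) scalar_field \<Rightarrow> 3 \<Rightarrow> (real ^ 3) vector_field" where
  "frame f1 f2 k x =
     (if k = 1 then f1 x *\<^sub>R coord_field 1 x
      else if k = 2 then f2 x *\<^sub>R coord_field 2 x
      else coord_field 3 x)"

lemma frame_orthonormal:
  assumes "f1 x \<noteq> 0" and "f2 x \<noteq> 0"
  shows "g_tilde f1 f2 x (frame f1 f2 j x) (frame f1 f2 k x) = (if j = k then 1 else 0)"
  using assms exhaust_3[of j] exhaust_3[of k]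
  by (auto simp: g_tilde_def frame_def coord_form_def coord_field_def axis_def power2_eq_square)

end

theory Submission
  imports Defs
begin

text \<open>In coordinates the Levi-Civita connection is \<open>D X Y = X(Y) + \<Gamma>(X, Y)\<close>; by the symmetry of second
  derivatives its curvature involves only \<open>\<Gamma>\<close> and its first derivatives, so the Ricci tensor is an
  algebraic expression at each point. The metric is the product of a surface metric in \<open>x\<^sup>1, x\<^sup>2\<close> and
  the line, so Ric is \<open>K\<close> times the surface part of the metric, \<open>K\<close> being its Gauss curvature. As
  \<open>\<partial>/\<partial>x\<^sup>3\<close> is a Killing field, the soliton equation reduces to \<open>K + \<lambda> = 0\<close> on the surface directions
  and \<open>\<lambda> + \<mu> = 0\<close> on the third one.\<close>

section \<open>Smooth maps\<close>

lemma has_derivative_cong_on: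
  assumes "open S" "x \<in> S" "\<And>y. y \<in> S \<Longrightarrow> f y = g y"
  shows "(f has_derivative F) (at x) \<longleftrightarrow> (g has_derivative F) (at x)"
  using has_derivative_transform_within_open[OF _ assms(1,2)] assms(3) by metis

text \<open>\<open>frechet_derivative\<close> is a choice among the maps satisfying
  \<open>has_derivative\<close>. Both functions admit the same such maps at \<open>x\<close>, so the
  choices agree even where there is no derivative.\<close>

lemma frechet_derivative_cong_on:
  assumes "open S" "x \<in> S" "\<And>y. y \<in> S \<Longrightarrow> f y = g y"
  shows "frechet_derivative f (at x) = frechet_derivative g (at x)"
  unfolding frechet_derivative_def using has_derivative_cong_on[OF assms] by simp

lemma Ck_on_cong:
  assumes "open S" "\<And>y. y \<in> S \<Longrightarrow> f y = g y"
  shows "Ck_on k S f \<longleftrightarrow> Ck_on k S g"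
  using assms(2)
proof (induction k arbitrary: f g)
  case 0
  then show ?case by (auto cong: continuous_on_cong)
next
  case (Suc k)
  have "f differentiable_on S \<longleftrightarrow> g differentiable_on S"
    unfolding differentiable_on_eq_differentiable_at[OF \<open>open S\<close>] differentiable_def
    using has_derivative_cong_on[OF \<open>open S\<close>, of _ f g] Suc.prems by simp
  moreover have "Ck_on k S (\<lambda>x. frechet_derivative f (at x) v)
      \<longleftrightarrow> Ck_on k S (\<lambda>x. frechet_derivative g (at x) v)" for v
    by (rule Suc.IH)
       (use frechet_derivative_cong_on[OF \<open>open S\<close>, of _ f g] Suc.prems in simp)
  ultimately show ?case by simp
qed

lemma smooth_on_cong:
  assumes "open S" "\<And>y. y \<in> S \<Longrightarrow> f y = g y"
  shows "smooth_on S f \<longleftrightarrow> smooth_on S g"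
  using Ck_on_cong[OF assms] by (simp add: smooth_on_def)

text \<open>Lets a derivative \<open>F\<close> supplied by a differentiation rule stand in for
  \<open>frechet_derivative\<close>, with which it agrees on \<open>S\<close>.\<close>

lemma Ck_on_SucI:
  assumes "open S" "\<And>x. x \<in> S \<Longrightarrow> (f has_derivative F x) (at x)"
    and "\<And>v. Ck_on k S (\<lambda>x. F x v)"
  shows "Ck_on (Suc k) S f"
proof -
  have "frechet_derivative f (at x) = F x" if "x \<in> S" for x
    using frechet_derivative_at[OF assms(2)[OF that]] by simp
  then have "Ck_on k S (\<lambda>x. frechet_derivative f (at x) v)" for v
    using Ck_on_cong[OF \<open>open S\<close>, of "\<lambda>x. frechet_derivative f (at x) v"] assms(3) by simp
  moreover have "f differentiable_on S"
    using assms(1,2) by (auto simp: differentiable_on_eq_differentiable_at differentiable_def)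
  ultimately show ?thesis by simp
qed

lemma Ck_on_has_derivative:
  assumes "open S" "x \<in> S" "Ck_on (Suc k) S f"
  shows "(f has_derivative frechet_derivative f (at x)) (at x)"
  using assms by (simp add: differentiable_on_eq_differentiable_at frechet_derivative_works)

lemma Ck_on_SucD: "Ck_on (Suc k) S f \<Longrightarrow> Ck_on k S f"
proof (induction k arbitrary: f)
  case 0
  then show ?case using differentiable_imp_continuous_on by auto
next
  case (Suc k)
  show ?case
    using Suc.IH Suc.prems by (subst Ck_on.simps) (auto simp only: Ck_on.simps(2)[of "Suc k"])
qed

section \<open>Closure properties at finite order\<close>

lemma Ck_on_const: "open S \<Longrightarrow> Ck_on k S (\<lambda>x. c)"
  by (induction k arbitrary: c) (auto simp: frechet_derivative_const)

lemma Ck_on_bounded_linear: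
  assumes "open S" "bounded_linear L" "Ck_on k S f"
  shows "Ck_on k S (\<lambda>x. L (f x))"
  using assms(3)
proof (induction k arbitrary: f)
  case 0
  then show ?case
    using bounded_linear.continuous_on[OF assms(2)] by simp
next
  case (Suc k)
  show ?case
    by (rule Ck_on_SucI[OF \<open>open S\<close>,
          OF bounded_linear.has_derivative[OF assms(2) Ck_on_has_derivative[OF \<open>open S\<close> _ Suc.prems]]])
       (use Suc in auto)
qed

lemma Ck_on_add:
  assumes "open S" "Ck_on k S f" "Ck_on k S g"
  shows "Ck_on k S (\<lambda>x. f x + g x)"
  using assms(2,3)
proof (induction k arbitrary: f g)
  case 0
  then show ?case by (simp add: continuous_on_add)
next
  case (Suc k)
  show ?case
    by (rule Ck_on_SucI[OF \<open>open S\<close>, OF has_derivative_add])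
       (use Suc Ck_on_has_derivative[OF \<open>open S\<close> _ Suc.prems(1)]
          Ck_on_has_derivative[OF \<open>open S\<close> _ Suc.prems(2)] in auto)
qed

text \<open>By the product rule the derivative is a sum of two terms of the same bilinear shape, one
  order lower. Multiplication and scaling are both instances.\<close>

lemma Ck_on_bounded_bilinear:
  assumes "open S" "bounded_bilinear B" "Ck_on k S f" "Ck_on k S g"
  shows "Ck_on k S (\<lambda>x. B (f x) (g x))"
  using assms(3,4)
proof (induction k arbitrary: f g)
  case 0
  then show ?case using bounded_bilinear.continuous_on[OF assms(2)] by simp
next
  case (Suc k)
  show ?case
  proof (rule Ck_on_SucI[OF \<open>open S\<close>])
    show "((\<lambda>x. B (f x) (g x)) has_derivative
        (\<lambda>v. B (f x) (frechet_derivative g (at x) v) + B (frechet_derivative f (at x) v) (g x))) (at x)"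
      if "x \<in> S" for x
      by (rule bounded_bilinear.FDERIV[OF assms(2)]
          Ck_on_has_derivative[OF \<open>open S\<close> that] Suc.prems)+
    show "Ck_on k S (\<lambda>x. B (f x) (frechet_derivative g (at x) v)
        + B (frechet_derivative f (at x) v) (g x))" for v
      by (rule Ck_on_add[OF \<open>open S\<close>]; rule Suc.IH)
         (use Suc.prems Ck_on_SucD in auto)
  qed
qed

text \<open>The derivative of \<open>1/f\<close> is the product of \<open>-1/f\<close>,
  \<open>Df\<close> and \<open>1/f\<close>, so the induction hypothesis is needed for the same
  \<open>f\<close> only.\<close>

lemma Ck_on_inverse:
  fixes f :: "'a::euclidean_space \<Rightarrow> real"
  assumes "open S" "\<And>x. x \<in> S \<Longrightarrow> f x \<noteq> 0" "Ck_on k S f"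
  shows "Ck_on k S (\<lambda>x. inverse (f x))"
  using assms(3)
proof (induction k)
  case 0
  then show ?case using assms(2) by (simp add: continuous_on_inverse)
next
  case (Suc k)
  note mult = Ck_on_bounded_bilinear[OF \<open>open S\<close> bounded_bilinear_mult]
  show ?case
  proof (rule Ck_on_SucI[OF \<open>open S\<close>])
    show "((\<lambda>x. inverse (f x)) has_derivative
        (\<lambda>v. - (inverse (f x) * frechet_derivative f (at x) v * inverse (f x)))) (at x)"
      if "x \<in> S" for x
      using Deriv.has_derivative_inverse[OF assms(2)[OF that] Ck_on_has_derivative[OF \<open>open S\<close> that Suc.prems]] .
    have "Ck_on k S (\<lambda>x. inverse (f x) * frechet_derivative f (at x) v * inverse (f x))" for v
      using Suc.IH[OF Ck_on_SucD[OF Suc.prems]] Suc.prems by (intro mult) auto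
    then show "Ck_on k S (\<lambda>x. - (inverse (f x) * frechet_derivative f (at x) v * inverse (f x)))" for v
      using Ck_on_bounded_linear[OF \<open>open S\<close> bounded_linear_minus[OF bounded_linear_ident]] by blast
  qed
qed

section \<open>Closure properties of smooth maps\<close>

lemma smooth_on_has_derivative:
  assumes "open S" "x \<in> S" "smooth_on S f"
  shows "(f has_derivative frechet_derivative f (at x)) (at x)"
  by (rule Ck_on_has_derivative[OF assms(1,2), of 0]) (use assms(3) in \<open>simp only: smooth_on_def\<close>)

lemma smooth_on_continuous_on: "smooth_on S f \<Longrightarrow> continuous_on S f"
  unfolding smooth_on_def using Ck_on.simps(1)[of S f] by blast

lemma smooth_on_frechet_derivative:
  "smooth_on S f \<Longrightarrow> smooth_on S (\<lambda>x. frechet_derivative f (at x) v)"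
  unfolding smooth_on_def using Ck_on.simps(2)[of _ S f] by blast

lemma smooth_on_const: "open S \<Longrightarrow> smooth_on S (\<lambda>x. c)"
  by (simp add: smooth_on_def Ck_on_const)

lemma smooth_on_bounded_linear:
  "open S \<Longrightarrow> bounded_linear L \<Longrightarrow> smooth_on S f \<Longrightarrow> smooth_on S (\<lambda>x. L (f x))"
  by (simp add: smooth_on_def Ck_on_bounded_linear)

lemma smooth_on_add:
  "open S \<Longrightarrow> smooth_on S f \<Longrightarrow> smooth_on S g \<Longrightarrow> smooth_on S (\<lambda>x. f x + g x)"
  by (simp add: smooth_on_def Ck_on_add)

lemma smooth_on_minus: "open S \<Longrightarrow> smooth_on S f \<Longrightarrow> smooth_on S (\<lambda>x. - f x)"
  by (rule smooth_on_bounded_linear[OF _ bounded_linear_minus[OF bounded_linear_ident]])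

lemma smooth_on_diff:
  "open S \<Longrightarrow> smooth_on S f \<Longrightarrow> smooth_on S g \<Longrightarrow> smooth_on S (\<lambda>x. f x - g x)"
  using smooth_on_add[OF _ _ smooth_on_minus, of S f g] by simp

lemma smooth_on_scaleR:
  "open S \<Longrightarrow> smooth_on S f \<Longrightarrow> smooth_on S g \<Longrightarrow> smooth_on S (\<lambda>x. f x *\<^sub>R g x)"
  by (simp add: smooth_on_def Ck_on_bounded_bilinear[OF _ bounded_bilinear_scaleR])

lemma smooth_on_mult:
  fixes f g :: "'a::euclidean_space \<Rightarrow> 'b::real_normed_algebra"
  shows "open S \<Longrightarrow> smooth_on S f \<Longrightarrow> smooth_on S g \<Longrightarrow> smooth_on S (\<lambda>x. f x * g x)"
  by (simp add: smooth_on_def Ck_on_bounded_bilinear[OF _ bounded_bilinear_mult])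

lemma smooth_on_divide:
  fixes f g :: "'a::euclidean_space \<Rightarrow> real"
  assumes "open S" "\<And>x. x \<in> S \<Longrightarrow> g x \<noteq> 0" "smooth_on S f" "smooth_on S g"
  shows "smooth_on S (\<lambda>x. f x / g x)"
  unfolding divide_inverse
  using assms by (intro smooth_on_mult) (auto simp: smooth_on_def Ck_on_inverse)

lemma smooth_on_sum:
  "open S \<Longrightarrow> (\<And>i. i \<in> A \<Longrightarrow> smooth_on S (f i)) \<Longrightarrow> smooth_on S (\<lambda>x. \<Sum>i\<in>A. f i x)"
  by (induction A rule: infinite_finite_induct) (auto intro: smooth_on_const smooth_on_add)

lemma smooth_on_nth:
  fixes X :: "'a::euclidean_space \<Rightarrow> real ^ 'n::finite"
  shows "open S \<Longrightarrow> smooth_on S X \<Longrightarrow> smooth_on S (\<lambda>x. X x $ i)"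
  by (rule smooth_on_bounded_linear[OF _ bounded_linear_vec_nth])

text \<open>\<open>Ck_on\<close> controls derivatives in constant directions only, so the direction
  \<open>X\<close> is expanded in the basis, with smooth coefficients.\<close>

lemma smooth_on_dir_deriv:
  assumes "open S" "smooth_on S X" "smooth_on S f"
  shows "smooth_on S (dir_deriv X f)"
proof -
  have "dir_deriv X f x = (\<Sum>b\<in>Basis. (X x \<bullet> b) *\<^sub>R frechet_derivative f (at x) b)"
    if "x \<in> S" for x
  proof -
    have "linear (frechet_derivative f (at x))"
      using smooth_on_has_derivative[OF assms(1) that assms(3)] has_derivative_linear by blast
    then show ?thesis
      unfolding dir_deriv_def by (subst (1) euclidean_representation[of "X x", symmetric])
        (simp only: linear_sum linear_cmul)
  qed
  moreover have "smooth_on S (\<lambda>x. \<Sum>b\<in>Basis. (X x \<bullet> b) *\<^sub>R frechet_derivative f (at x) b)"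
    using assms by (intro smooth_on_sum smooth_on_scaleR smooth_on_frechet_derivative
        smooth_on_bounded_linear[OF _ bounded_linear_inner_left]) auto
  ultimately show ?thesis
    using smooth_on_cong[OF assms(1), of "dir_deriv X f"] by simp
qed

section \<open>Symmetry of second derivatives\<close>

text \<open>The mean value theorem is applied twice: along \<open>u\<close> to the difference of
  \<open>f\<close> between two parallel sides, then along \<open>v\<close> to the derivative of
  \<open>f\<close> in direction \<open>u\<close>.\<close>

lemma second_difference_mvt:
  fixes f :: "'a::euclidean_space \<Rightarrow> real"
  assumes "open S" "smooth_on S f" "h > 0"
    and box: "\<And>s t. s \<in> {0..h} \<Longrightarrow> t \<in> {0..h} \<Longrightarrow> x + s *\<^sub>R u + t *\<^sub>R v \<in> S"
  obtains s t where "s \<in> {0..h}" "t \<in> {0..h}"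
    and "f (x + h *\<^sub>R u + h *\<^sub>R v) - f (x + h *\<^sub>R u) - f (x + h *\<^sub>R v) + f x
      = h\<^sup>2 * frechet_derivative (\<lambda>y. frechet_derivative f (at y) u) (at (x + s *\<^sub>R u + t *\<^sub>R v)) v"
proof -
  define Du where "Du y = frechet_derivative f (at y) u" for y
  have line: "((\<lambda>s. F (p + s *\<^sub>R w)) has_real_derivative frechet_derivative F (at (p + s *\<^sub>R w)) w) (at s)"
    if "smooth_on S F" "p + s *\<^sub>R w \<in> S" for F :: "'a \<Rightarrow> real" and p w s
  proof -
    have "linear (frechet_derivative F (at (p + s *\<^sub>R w)))"
      using smooth_on_has_derivative[OF assms(1) that(2,1)] has_derivative_linear by blast
    moreover have "((\<lambda>s. p + s *\<^sub>R w) has_derivative (\<lambda>r. r *\<^sub>R w)) (at s)"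
      by (auto intro!: derivative_eq_intros)
    from has_derivative_compose[OF this smooth_on_has_derivative[OF assms(1) that(2,1)]]
    have "((\<lambda>s. F (p + s *\<^sub>R w)) has_derivative
        (\<lambda>r. frechet_derivative F (at (p + s *\<^sub>R w)) (r *\<^sub>R w))) (at s)" .
    ultimately show ?thesis
      by (simp add: has_field_derivative_def linear_cmul mult.commute[of _ "frechet_derivative F _ _"])
  qed
  have "((\<lambda>s. f (x + h *\<^sub>R v + s *\<^sub>R u) - f (x + s *\<^sub>R u)) has_real_derivative
      Du (x + h *\<^sub>R v + s *\<^sub>R u) - Du (x + s *\<^sub>R u)) (at s)" if "0 \<le> s" "s \<le> h" for s
    unfolding Du_def using box[of s h] box[of s 0] that assms(3)
    by (intro DERIV_diff line[OF assms(2)]) (auto simp: algebra_simps)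
  from MVT2[OF assms(3) this] obtain s where s: "0 < s" "s < h"
    and 1: "f (x + h *\<^sub>R v + h *\<^sub>R u) - f (x + h *\<^sub>R u) - (f (x + h *\<^sub>R v) - f x)
      = h * (Du (x + h *\<^sub>R v + s *\<^sub>R u) - Du (x + s *\<^sub>R u))"
    by auto
  have "((\<lambda>t. Du (x + s *\<^sub>R u + t *\<^sub>R v)) has_real_derivative
      frechet_derivative Du (at (x + s *\<^sub>R u + t *\<^sub>R v)) v) (at t)" if "0 \<le> t" "t \<le> h" for t
    using box[of s t] that s smooth_on_frechet_derivative[OF assms(2)]
    unfolding Du_def by (intro line) auto
  from MVT2[OF assms(3) this] obtain t where t: "0 < t" "t < h"
    and 2: "Du (x + s *\<^sub>R u + h *\<^sub>R v) - Du (x + s *\<^sub>R u)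
      = h * frechet_derivative Du (at (x + s *\<^sub>R u + t *\<^sub>R v)) v"
    by auto
  show thesis
    using s t 1 2 by (intro that[of s t]) (auto simp: Du_def[abs_def] algebra_simps power2_eq_square)
qed

text \<open>Schwarz's theorem. The second difference is symmetric in \<open>u\<close> and
  \<open>v\<close>, so the two mixed derivatives agree at a pair of points arbitrarily close to
  \<open>x\<close>; continuity carries the equality to \<open>x\<close>.\<close>

lemma frechet_derivative_commute_real:
  fixes f :: "'a::euclidean_space \<Rightarrow> real"
  assumes "open S" "x \<in> S" "smooth_on S f"
  shows "frechet_derivative (\<lambda>y. frechet_derivative f (at y) u) (at x) v
    = frechet_derivative (\<lambda>y. frechet_derivative f (at y) v) (at x) u"
proof -
  define P where "P u v y = frechet_derivative (\<lambda>y. frechet_derivative f (at y) u) (at y) v" for u v y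
  have cont: "isCont (P u v) x" for u v
    unfolding P_def using assms
    by (metis continuous_on_eq_continuous_at smooth_on_continuous_on smooth_on_frechet_derivative)
  have "\<bar>P u v x - P v u x\<bar> < e" if "e > 0" for e
  proof -
    have "\<exists>d>0. \<forall>y. dist y x < d \<longrightarrow> dist (P u v y) (P u v x) < e / 2" for u v
      using cont[of u v] \<open>e > 0\<close> half_gt_zero unfolding continuous_at_eps_delta by blast
    then obtain d1 d2 where d1: "d1 > 0" "\<And>y. dist y x < d1 \<Longrightarrow> dist (P u v y) (P u v x) < e / 2"
      and d2: "d2 > 0" "\<And>y. dist y x < d2 \<Longrightarrow> dist (P v u y) (P v u x) < e / 2"
      by metis
    obtain d3 where d3: "d3 > 0" "\<And>y. dist y x < d3 \<Longrightarrow> y \<in> S"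
      using assms(1,2) by (metis open_dist)
    define d where "d = min d1 (min d2 d3)"
    \<comment> \<open>This size keeps the parallelogram within distance \<open>d / 2\<close> of
      \<open>x\<close>; the summand 1 avoids division by zero when both directions vanish.\<close>
    define h where "h = d / (2 * (1 + norm u + norm v))"
    have d: "d > 0" using d1 d2 d3 by (simp add: d_def)
    have pos: "1 + norm u + norm v > 0" by (smt (verit) norm_ge_zero)
    have "h > 0" unfolding h_def using d pos by simp
    have near: "dist (x + s *\<^sub>R u + t *\<^sub>R v) x < d" if "s \<in> {0..h}" "t \<in> {0..h}" for s t
    proof -
      have "dist (x + s *\<^sub>R u + t *\<^sub>R v) x \<le> s * norm u + t * norm v"
        using that norm_triangle_ineq[of "s *\<^sub>R u" "t *\<^sub>R v"] by (simp add: dist_norm add.assoc)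
      also have "\<dots> \<le> h * norm u + h * norm v"
        using that by (intro add_mono mult_right_mono) auto
      also have "\<dots> \<le> h * (1 + norm u + norm v)" using \<open>h > 0\<close> by (simp add: algebra_simps)
      also have "\<dots> = d / 2"
        unfolding h_def using less_imp_neq[OF pos] by (simp add: divide_simps)
      also have "\<dots> < d" using d by simp
      finally show ?thesis .
    qed
    have "x + s *\<^sub>R u + t *\<^sub>R v \<in> S" if "s \<in> {0..h}" "t \<in> {0..h}" for s t
      using near[OF that] d3 by (simp add: d_def)
    from second_difference_mvt[OF assms(1,3) \<open>h > 0\<close> this]
    obtain s t where st: "s \<in> {0..h}" "t \<in> {0..h}"
      "f (x + h *\<^sub>R u + h *\<^sub>R v) - f (x + h *\<^sub>R u) - f (x + h *\<^sub>R v) + f x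
        = h\<^sup>2 * P u v (x + s *\<^sub>R u + t *\<^sub>R v)"
      unfolding P_def by metis
    have "x + s *\<^sub>R v + t *\<^sub>R u \<in> S" if "s \<in> {0..h}" "t \<in> {0..h}" for s t
      using near[OF that(2,1)] d3 by (simp add: d_def add_ac)
    from second_difference_mvt[OF assms(1,3) \<open>h > 0\<close> this]
    obtain s' t' where st': "s' \<in> {0..h}" "t' \<in> {0..h}"
      "f (x + h *\<^sub>R v + h *\<^sub>R u) - f (x + h *\<^sub>R v) - f (x + h *\<^sub>R u) + f x
        = h\<^sup>2 * P v u (x + s' *\<^sub>R v + t' *\<^sub>R u)"
      unfolding P_def by metis
    have "x + h *\<^sub>R v + h *\<^sub>R u = x + h *\<^sub>R u + h *\<^sub>R v" by simp
    then have "h\<^sup>2 * P u v (x + s *\<^sub>R u + t *\<^sub>R v) = h\<^sup>2 * P v u (x + s' *\<^sub>R v + t' *\<^sub>R u)"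
      using st(3) st'(3) by (simp only:)
    then have "P u v (x + s *\<^sub>R u + t *\<^sub>R v) = P v u (x + s' *\<^sub>R v + t' *\<^sub>R u)"
      using \<open>h > 0\<close> by simp
    moreover have "dist (x + s' *\<^sub>R v + t' *\<^sub>R u) x < d"
      using near[OF st'(2,1)] by (simp add: add_ac)
    ultimately have "dist (P v u (x + s' *\<^sub>R v + t' *\<^sub>R u)) (P u v x) < e / 2"
      "dist (P v u (x + s' *\<^sub>R v + t' *\<^sub>R u)) (P v u x) < e / 2"
      using d1(2)[of "x + s *\<^sub>R u + t *\<^sub>R v"] d2(2)[of "x + s' *\<^sub>R v + t' *\<^sub>R u"] near[OF st(1,2)]
      unfolding d_def by auto
    then show ?thesis unfolding dist_real_def by linarith
  qed
  \<comment> \<open>A nonzero difference would be smaller than itself.\<close>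
  from this[of "\<bar>P u v x - P v u x\<bar>"] have "P u v x = P v u x"
    by linarith
  then show ?thesis by (simp add: P_def)
qed

text \<open>Taking the inner product with a basis vector commutes with both derivatives and reduces
  the claim to real-valued maps.\<close>

lemma frechet_derivative_commute:
  fixes f :: "'a::euclidean_space \<Rightarrow> 'b::euclidean_space"
  assumes "open S" "x \<in> S" "smooth_on S f"
  shows "frechet_derivative (\<lambda>y. frechet_derivative f (at y) u) (at x) v
    = frechet_derivative (\<lambda>y. frechet_derivative f (at y) v) (at x) u"
proof (rule euclidean_eqI)
  fix b :: 'b
  have inner: "frechet_derivative (\<lambda>y. g y \<bullet> b) (at z) = (\<lambda>w. frechet_derivative g (at z) w \<bullet> b)"
    if "z \<in> S" "smooth_on S g" for z and g :: "'a \<Rightarrow> 'b"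
    using frechet_derivative_at[OF bounded_linear.has_derivative[OF bounded_linear_inner_left
          smooth_on_has_derivative[OF assms(1) that]]] by simp
  have twice: "frechet_derivative (\<lambda>y. frechet_derivative f (at y) u) (at x) v \<bullet> b
    = frechet_derivative (\<lambda>y. frechet_derivative (\<lambda>y. f y \<bullet> b) (at y) u) (at x) v" for u v
  proof -
    have "frechet_derivative (\<lambda>y. frechet_derivative (\<lambda>y. f y \<bullet> b) (at y) u) (at x)
      = frechet_derivative (\<lambda>y. frechet_derivative f (at y) u \<bullet> b) (at x)"
      by (rule frechet_derivative_cong_on[OF assms(1,2)]) (simp add: inner assms(3))
    then show ?thesis
      by (simp add: inner[OF assms(2) smooth_on_frechet_derivative[OF assms(3)]])
  qed
  show "frechet_derivative (\<lambda>y. frechet_derivative f (at y) u) (at x) v \<bullet> b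
    = frechet_derivative (\<lambda>y. frechet_derivative f (at y) v) (at x) u \<bullet> b"
    unfolding twice
    by (rule frechet_derivative_commute_real[OF assms(1,2)])
       (rule smooth_on_bounded_linear[OF assms(1) bounded_linear_inner_left assms(3)])
qed

text \<open>A product rule for \<open>Df\<close> applied to a moving vector. The first term is a
  second derivative with the vector frozen at its value at \<open>x\<close>, the form in which
  symmetry applies.\<close>

lemma smooth_on_frechet_eval:
  assumes "open S" "x \<in> S" "smooth_on S f" "smooth_on S X"
  shows "((\<lambda>y. frechet_derivative f (at y) (X y)) has_derivative
    (\<lambda>v. frechet_derivative (\<lambda>y. frechet_derivative f (at y) (X x)) (at x) v
       + frechet_derivative f (at x) (frechet_derivative X (at x) v))) (at x)"
proof -
  define Df where "Df b y = frechet_derivative f (at y) b" for b y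
  have lin: "linear (frechet_derivative f (at y))" if "y \<in> S" for y
    using smooth_on_has_derivative[OF assms(1) that assms(3)] has_derivative_linear by blast
  have expand: "frechet_derivative f (at y) w = (\<Sum>b\<in>Basis. (w \<bullet> b) *\<^sub>R Df b y)" if "y \<in> S" for y w
    unfolding Df_def by (subst (1) euclidean_representation[of w, symmetric])
      (simp only: linear_sum[OF lin[OF that]] linear_cmul[OF lin[OF that]])
  have Df: "(Df b has_derivative frechet_derivative (Df b) (at x)) (at x)" for b
    unfolding Df_def
    by (rule smooth_on_has_derivative[OF assms(1,2) smooth_on_frechet_derivative[OF assms(3)]])
  note X = smooth_on_has_derivative[OF assms(1,2,4)]
  have "((\<lambda>y. \<Sum>b\<in>Basis. (X x \<bullet> b) *\<^sub>R Df b y) has_derivative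
      (\<lambda>v. \<Sum>b\<in>Basis. (X x \<bullet> b) *\<^sub>R frechet_derivative (Df b) (at x) v)) (at x)"
    by (intro has_derivative_sum has_derivative_scaleR_right Df)
  note frechet_derivative_at[OF this, symmetric]
  moreover have "frechet_derivative (\<lambda>y. frechet_derivative f (at y) (X x)) (at x)
      = frechet_derivative (\<lambda>y. \<Sum>b\<in>Basis. (X x \<bullet> b) *\<^sub>R Df b y) (at x)"
    by (rule frechet_derivative_cong_on[OF assms(1,2) expand])
  ultimately have fixed: "frechet_derivative (\<lambda>y. frechet_derivative f (at y) (X x)) (at x)
      = (\<lambda>v. \<Sum>b\<in>Basis. (X x \<bullet> b) *\<^sub>R frechet_derivative (Df b) (at x) v)"
    by (rule trans[rotated])
  have "((\<lambda>y. \<Sum>b\<in>Basis. (X y \<bullet> b) *\<^sub>R Df b y) has_derivative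
      (\<lambda>v. \<Sum>b\<in>Basis. (X x \<bullet> b) *\<^sub>R frechet_derivative (Df b) (at x) v
        + (frechet_derivative X (at x) v \<bullet> b) *\<^sub>R Df b x)) (at x)"
    by (intro has_derivative_sum has_derivative_scaleR has_derivative_inner_left X Df)
  then show ?thesis
    unfolding fixed sum.distrib expand[OF assms(2), of "frechet_derivative X (at x) _", symmetric]
    by (subst has_derivative_cong_on[OF assms(1,2) expand])
qed

section \<open>The Levi-Civita connection\<close>

text \<open>The difference of two Levi-Civita connections is symmetric in its two arguments and
  skew-adjoint in the second one; permuting three fields shows that it vanishes.\<close>

lemma is_levi_civita_on_unique:
  assumes "open S" "is_levi_civita_on S g D" "is_levi_civita_on S g D'"
    and "x \<in> S" "bilinear (g x)" "\<And>v w. g x v w = g x w v" "\<And>v. g x v v = 0 \<Longrightarrow> v = 0"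
    and "smooth_on S X" "smooth_on S Y"
  shows "D X Y x = D' X Y x"
proof -
  define A where "A X Y = D X Y x - D' X Y x" for X Y
  have sym: "A U V = A V U" if "smooth_on S U" "smooth_on S V" for U V
  proof -
    have "D U V x - D V U x = D' U V x - D' V U x"
      using assms(2-4) that unfolding is_levi_civita_on_def by simp
    then show ?thesis unfolding A_def by (simp add: algebra_simps)
  qed
  have skew: "g x (A U V) (W x) = - g x (A U W) (V x)"
    if "smooth_on S U" "smooth_on S V" "smooth_on S W" for U V W
  proof -
    have "dir_deriv U (\<lambda>y. g y (V y) (W y)) x = g x (C U V x) (W x) + g x (V x) (C U W x)"
      if "is_levi_civita_on S g C" for C
      using that \<open>smooth_on S U\<close> \<open>smooth_on S V\<close> \<open>smooth_on S W\<close> assms(4)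
      unfolding is_levi_civita_on_def by simp
    from this[OF assms(2)] this[OF assms(3)]
    have "g x (D U V x) (W x) + g x (V x) (D U W x) = g x (D' U V x) (W x) + g x (V x) (D' U W x)"
      by simp
    then show ?thesis
      unfolding A_def using assms(6)[of "V x"] by (simp add: bilinear_lsub[OF assms(5)])
  qed
  \<comment> \<open>The constant field whose value is the difference tensor at \<open>x\<close>:
    testing against it turns the vanishing of all products into the vanishing of one square
    norm.\<close>
  define Z where "Z = (\<lambda>y::'a. A X Y)"
  have Z: "smooth_on S Z" unfolding Z_def by (rule smooth_on_const[OF assms(1)])
  have "g x (A X Y) (Z x) = - g x (A Z X) (Y x)"
    using skew[OF assms(8,9) Z] sym[OF assms(8) Z] by simp
  also have "\<dots> = g x (A Y Z) (X x)"
    using skew[OF Z assms(8,9)] sym[OF assms(9) Z] by simp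
  also have "\<dots> = - g x (A X Y) (Z x)"
    using skew[OF assms(9) Z assms(8)] sym[OF assms(8,9)] by simp
  finally have "g x (A X Y) (A X Y) = 0" by (simp add: Z_def)
  from assms(7)[OF this] show ?thesis by (simp add: A_def)
qed

text \<open>\<open>G x v w\<close> is the vector with components \<open>\<Gamma>\<^sup>k\<^sub>i\<^sub>j v\<^sup>i w\<^sup>j\<close>, and \<open>G' x u\<close> is the derivative of \<open>G\<close> at \<open>x\<close> in
  the direction \<open>u\<close>.\<close>

locale christoffel =
  fixes S :: "'a::euclidean_space set"
    and G :: "'a \<Rightarrow> 'a \<Rightarrow> 'a \<Rightarrow> 'a" and G' :: "'a \<Rightarrow> 'a \<Rightarrow> 'a \<Rightarrow> 'a \<Rightarrow> 'a"
  assumes open_dom: "open S"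
    and bilin: "\<And>x. x \<in> S \<Longrightarrow> bilinear (G x)"
    and sym: "\<And>x v w. x \<in> S \<Longrightarrow> G x v w = G x w v"
    and smooth: "\<And>X Y. smooth_on S X \<Longrightarrow> smooth_on S Y \<Longrightarrow> smooth_on S (\<lambda>x. G x (X x) (Y x))"
    and deriv: "\<And>X Y x. smooth_on S X \<Longrightarrow> smooth_on S Y \<Longrightarrow> x \<in> S \<Longrightarrow>
      ((\<lambda>y. G y (X y) (Y y)) has_derivative
        (\<lambda>v. G' x v (X x) (Y x) + G x (frechet_derivative X (at x) v) (Y x)
          + G x (X x) (frechet_derivative Y (at x) v))) (at x)"
begin

section \<open>The connection of given Christoffel symbols and its curvature\<close>

definition conn :: "'a connection" where
  "conn X Y x = dir_deriv X Y x + G x (X x) (Y x)"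

lemma smooth_conn: "smooth_on S X \<Longrightarrow> smooth_on S Y \<Longrightarrow> smooth_on S (conn X Y)"
  unfolding conn_def[abs_def] by (intro smooth_on_add open_dom smooth_on_dir_deriv smooth)

lemma linear_deriv:
  assumes "smooth_on S f" "x \<in> S"
  shows "linear (frechet_derivative f (at x))"
  using smooth_on_has_derivative[OF open_dom assms(2,1)] has_derivative_linear by blast

lemma affine_connection_conn: "affine_connection_on S conn"
  unfolding affine_connection_on_def
proof (intro conjI allI impI ballI)
  fix X Y Z :: "'a vector_field" and f :: "'a \<Rightarrow> real" and x
  assume f: "smooth_on S f" and X: "smooth_on S X" and Y: "smooth_on S Y" and x: "x \<in> S"
  have "((\<lambda>y. f y *\<^sub>R Y y) has_derivative
    (\<lambda>v. f x *\<^sub>R frechet_derivative Y (at x) v + frechet_derivative f (at x) v *\<^sub>R Y x)) (at x)"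
    by (intro has_derivative_scaleR smooth_on_has_derivative[OF open_dom x] f Y)
  from frechet_derivative_at[OF this, symmetric]
  show "conn X (\<lambda>y. f y *\<^sub>R Y y) x = dir_deriv X f x *\<^sub>R Y x + f x *\<^sub>R conn X Y x"
    by (simp add: conn_def dir_deriv_def bilinear_rmul[OF bilin[OF x]] algebra_simps)
  show "conn (\<lambda>y. f y *\<^sub>R X y) Y x = f x *\<^sub>R conn X Y x"
    using linear_deriv[OF Y x]
    by (simp add: conn_def dir_deriv_def bilinear_lmul[OF bilin[OF x]] linear_cmul algebra_simps)
next
  fix X Y Z :: "'a vector_field" and x
  assume X: "smooth_on S X" and Y: "smooth_on S Y" and Z: "smooth_on S Z" and x: "x \<in> S"
  show "conn (\<lambda>y. X y + Y y) Z x = conn X Z x + conn Y Z x"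
    using linear_deriv[OF Z x]
    by (simp add: conn_def dir_deriv_def bilinear_ladd[OF bilin[OF x]] linear_add algebra_simps)
  have "((\<lambda>y. Y y + Z y) has_derivative
    (\<lambda>v. frechet_derivative Y (at x) v + frechet_derivative Z (at x) v)) (at x)"
    by (intro has_derivative_add smooth_on_has_derivative[OF open_dom x] Y Z)
  from frechet_derivative_at[OF this, symmetric]
  show "conn X (\<lambda>y. Y y + Z y) x = conn X Y x + conn X Z x"
    by (simp add: conn_def dir_deriv_def bilinear_radd[OF bilin[OF x]] algebra_simps)
qed (rule smooth_conn)

lemma torsion_free_conn: "x \<in> S \<Longrightarrow> conn X Y x - conn Y X x = lie_bracket X Y x"
  using sym[of x] by (simp add: conn_def lie_bracket_def)

text \<open>Sorts the second covariant derivative by the derivatives of \<open>Y\<close> and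
  \<open>Z\<close>, so that antisymmetrising in \<open>X\<close> and \<open>Y\<close> cancels term
  by term.\<close>

lemma conn_conn:
  assumes "smooth_on S X" "smooth_on S Y" "smooth_on S Z" "x \<in> S"
  shows "conn X (conn Y Z) x =
      frechet_derivative (\<lambda>y. frechet_derivative Z (at y) (Y x)) (at x) (X x)
      + frechet_derivative Z (at x) (dir_deriv X Y x)
      + G' x (X x) (Y x) (Z x) + G x (dir_deriv X Y x) (Z x) + G x (Y x) (dir_deriv X Z x)
      + G x (X x) (dir_deriv Y Z x) + G x (X x) (G x (Y x) (Z x))"
proof -
  have "(conn Y Z has_derivative
      (\<lambda>v. (frechet_derivative (\<lambda>y. frechet_derivative Z (at y) (Y x)) (at x) v
         + frechet_derivative Z (at x) (frechet_derivative Y (at x) v))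
       + (G' x v (Y x) (Z x) + G x (frechet_derivative Y (at x) v) (Z x)
          + G x (Y x) (frechet_derivative Z (at x) v)))) (at x)"
    unfolding conn_def[abs_def] dir_deriv_def
    by (intro has_derivative_add smooth_on_frechet_eval[OF open_dom] deriv assms)
  from frechet_derivative_at[OF this, symmetric] show ?thesis
    unfolding conn_def[of X "conn Y Z"]
    by (simp add: dir_deriv_def conn_def[of Y Z] bilinear_radd[OF bilin[OF assms(4)]])
qed

text \<open>Second derivatives of \<open>Z\<close> cancel by symmetry, terms with one derivative of
  \<open>Z\<close> inside \<open>G\<close> are symmetric in \<open>X\<close> and \<open>Y\<close>,
  and derivatives of \<open>X\<close> and \<open>Y\<close> are absorbed by the bracket term.\<close>

lemma curvature_conn:
  assumes "smooth_on S X" "smooth_on S Y" "smooth_on S Z" "x \<in> S"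
  shows "curvature conn X Y Z x =
    G' x (X x) (Y x) (Z x) - G' x (Y x) (X x) (Z x)
    + G x (X x) (G x (Y x) (Z x)) - G x (Y x) (G x (X x) (Z x))"
proof -
  have "conn (lie_bracket X Y) Z x =
      frechet_derivative Z (at x) (dir_deriv X Y x) - frechet_derivative Z (at x) (dir_deriv Y X x)
      + G x (dir_deriv X Y x) (Z x) - G x (dir_deriv Y X x) (Z x)"
    using linear_deriv[OF assms(3,4)]
    by (simp add: conn_def lie_bracket_def dir_deriv_def[of "lie_bracket X Y"]
        linear_diff bilinear_lsub[OF bilin[OF assms(4)]])
  moreover have "frechet_derivative (\<lambda>y. frechet_derivative Z (at y) (Y x)) (at x) (X x)
      = frechet_derivative (\<lambda>y. frechet_derivative Z (at y) (X x)) (at x) (Y x)"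
    by (rule frechet_derivative_commute[OF open_dom assms(4,3)])
  ultimately show ?thesis
    unfolding curvature_def conn_conn[OF assms] conn_conn[OF assms(2,1,3,4)]
    by simp
qed

text \<open>\<open>levi_civita\<close> is an arbitrary choice, pinned down only on \<open>S\<close>
  and for smooth fields. Hence every field to which it is applied here must be shown smooth.\<close>

lemma curvature_levi_civita:
  assumes "is_levi_civita_on S g conn"
    and "\<And>x. x \<in> S \<Longrightarrow> bilinear (g x)" "\<And>x v w. x \<in> S \<Longrightarrow> g x v w = g x w v"
    and "\<And>x v. x \<in> S \<Longrightarrow> g x v v = 0 \<Longrightarrow> v = 0"
    and "smooth_on S X" "smooth_on S Y" "smooth_on S Z" "x \<in> S"
  shows "curvature (levi_civita S g) X Y Z x = curvature conn X Y Z x"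
proof -
  let ?D = "levi_civita S g"
  have D: "is_levi_civita_on S g ?D"
    unfolding levi_civita_def by (rule someI[of "is_levi_civita_on S g", OF assms(1)])
  have eq: "?D U V y = conn U V y" if "smooth_on S U" "smooth_on S V" "y \<in> S" for U V y
    by (rule is_levi_civita_on_unique[OF open_dom D assms(1)]) (use that assms(2-4) in auto)
  have eq2: "?D U (?D V Z) x = conn U (conn V Z) x" if "smooth_on S U" "smooth_on S V" for U V
  proof -
    have "smooth_on S (?D V Z)"
      using D that assms(7) by (simp add: is_levi_civita_on_def affine_connection_on_def)
    then have "?D U (?D V Z) x = conn U (?D V Z) x" by (rule eq[OF that(1) _ assms(8)])
    also have "\<dots> = conn U (conn V Z) x"
      \<comment> \<open>The two inner fields are known to agree on \<open>S\<close> only;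
        \<open>conn\<close> sees no more, being a first-order differential operator.\<close>
      using frechet_derivative_cong_on[OF open_dom assms(8), of "?D V Z" "conn V Z"]
        eq[OF that(2) assms(7)] assms(8)
      by (simp add: conn_def[of U] dir_deriv_def[of U])
    finally show ?thesis .
  qed
  have "smooth_on S (lie_bracket X Y)"
    unfolding lie_bracket_def[abs_def]
    by (intro smooth_on_diff smooth_on_dir_deriv open_dom assms(5,6))
  then show ?thesis
    unfolding curvature_def using eq eq2 assms(5-8) by simp
qed

end

section \<open>Functions of the second coordinate\<close>

text \<open>The infinitesimal form of dependence on \<open>x\<^sup>2\<close> alone. It is local and
  passes to derivatives and quotients by differentiation rules.\<close>

definition second_coord_only :: "(real ^ 3) set \<Rightarrow> (real ^ 3 \<Rightarrow> real) \<Rightarrow> bool" where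
  "second_coord_only S f \<longleftrightarrow> (\<forall>x\<in>S. partial 1 f x = 0 \<and> partial 3 f x = 0)"

lemma second_coord_only_has_derivative:
  assumes "open S" "x \<in> S" "smooth_on S f" "second_coord_only S f"
  shows "(f has_derivative (\<lambda>v. v $ 2 * partial 2 f x)) (at x)"
proof -
  let ?D = "frechet_derivative f (at x)"
  note D = smooth_on_has_derivative[OF assms(1,2,3)]
  have "?D v = v $ 2 * partial 2 f x" for v
  proof -
    have "v = v $ 1 *\<^sub>R axis 1 1 + v $ 2 *\<^sub>R axis 2 1 + v $ 3 *\<^sub>R axis 3 1"
      by (simp add: vec_eq_iff forall_3 axis_def)
    then have "?D v = v $ 1 *\<^sub>R ?D (axis 1 1) + v $ 2 *\<^sub>R ?D (axis 2 1) + v $ 3 *\<^sub>R ?D (axis 3 1)"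
      using linear_add[OF has_derivative_linear[OF D]] linear_cmul[OF has_derivative_linear[OF D]]
      by metis
    then show ?thesis
      using assms(2,4) by (simp add: second_coord_only_def partial_def dir_deriv_def coord_field_def)
  qed
  then show ?thesis using D by presburger
qed

lemma partial_eqI:
  assumes "(f has_derivative D) (at x)" shows "partial i f x = D (axis i 1)"
  by (simp add: partial_def dir_deriv_def coord_field_def frechet_derivative_at[OF assms, symmetric])

lemma smooth_on_partial: "smooth_on S f \<Longrightarrow> smooth_on S (partial i f)"
  unfolding partial_def dir_deriv_def[abs_def] coord_field_def by (rule smooth_on_frechet_derivative)

text \<open>Mixed partial derivatives commute, and a function vanishing on \<open>S\<close> has zero
  derivative there.\<close>

lemma second_coord_only_partial:
  assumes "open S" "smooth_on S f" "second_coord_only S f"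
  shows "second_coord_only S (partial 2 f)"
proof -
  have "partial i (partial 2 f) x = 0" if "x \<in> S" "\<And>y. y \<in> S \<Longrightarrow> partial i f y = 0" for i x
  proof -
    have "partial i (partial 2 f) x = partial 2 (partial i f) x"
      using frechet_derivative_commute[OF assms(1) that(1) assms(2), of "axis 2 1" "axis i 1"]
      by (simp add: partial_def dir_deriv_def[abs_def] coord_field_def)
    also have "\<dots> = 0"
      using frechet_derivative_cong_on[OF assms(1) that(1), of "partial i f" "\<lambda>_. 0"] that(2)
      by (simp add: partial_def[of 2] dir_deriv_def)
    finally show ?thesis .
  qed
  then show ?thesis using assms(3) by (simp add: second_coord_only_def)
qed

text \<open>For \<open>i \<noteq> 2\<close>, moving along the axis \<open>i\<close> keeps the second
  coordinate, so \<open>f\<close> is constant near parameter 0 on that line; the chain rule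
  identifies the partial derivative with the zero derivative along it.\<close>

lemma second_coord_only_if_const:
  assumes "open S" "smooth_on S f"
    and "\<And>x y. x \<in> S \<Longrightarrow> y \<in> S \<Longrightarrow> x $ 2 = y $ 2 \<Longrightarrow> f x = f y"
  shows "second_coord_only S f"
proof -
  have "partial i f x = 0" if "x \<in> S" "i \<noteq> 2" for i x
  proof -
    let ?p = "\<lambda>t. x + t *\<^sub>R axis i 1"
    have "open (?p -` S)"
      by (intro open_vimage assms continuous_intros)
    moreover have "(0::real) \<in> ?p -` S" using that by simp
    moreover have "f (?p t) = f x" if "t \<in> ?p -` S" for t
      using that \<open>x \<in> S\<close> \<open>i \<noteq> 2\<close> by (intro assms(3)) (auto simp: axis_def)
    ultimately have "((\<lambda>t. f (?p t)) has_derivative (\<lambda>_. 0)) (at 0)"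
      using has_derivative_cong_on[of "?p -` S" 0 "\<lambda>t. f (?p t)" "\<lambda>_. f x"] by simp
    moreover have "(?p has_derivative (\<lambda>t. t *\<^sub>R axis i 1)) (at 0)"
      by (auto intro!: derivative_eq_intros)
    from has_derivative_compose[OF this, of f "frechet_derivative f (at x)"]
    have "((\<lambda>t. f (?p t)) has_derivative (\<lambda>t. frechet_derivative f (at x) (t *\<^sub>R axis i 1))) (at 0)"
      using smooth_on_has_derivative[OF assms(1) that(1) assms(2)] by simp
    ultimately have "(\<lambda>t. frechet_derivative f (at x) (t *\<^sub>R axis i 1)) = (\<lambda>_. 0)"
      by (rule has_derivative_unique[rotated])
    from fun_cong[OF this, of 1] show ?thesis
      by (simp add: partial_def dir_deriv_def coord_field_def)
  qed
  then show ?thesis by (simp add: second_coord_only_def)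
qed

section \<open>The metric\<close>

locale diagonal_metric =
  fixes S :: "(real ^ 3) set" and f1 f2 :: "real ^ 3 \<Rightarrow> real"
  assumes open_S: "open S"
    and smooth_f: "smooth_on S f1" "smooth_on S f2"
    and f_nz: "\<And>x. x \<in> S \<Longrightarrow> f1 x \<noteq> 0" "\<And>x. x \<in> S \<Longrightarrow> f2 x \<noteq> 0"
    and f_second: "second_coord_only S f1" "second_coord_only S f2"
begin

text \<open>The non-zero Christoffel symbols of \<open>g_tilde f1 f2\<close> are \<open>\<Gamma>\<^sup>1\<^sub>1\<^sub>2 = \<Gamma>\<^sup>1\<^sub>2\<^sub>1 = - a\<close>, \<open>\<Gamma>\<^sup>2\<^sub>1\<^sub>1 = h\<close> and
  \<open>\<Gamma>\<^sup>2\<^sub>2\<^sub>2 = - b\<close>; \<open>h'\<close> is the derivative of \<open>h\<close> with respect to the second coordinate.\<close>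

definition a :: "real ^ 3 \<Rightarrow> real" where "a x = partial 2 f1 x / f1 x"
definition b :: "real ^ 3 \<Rightarrow> real" where "b x = partial 2 f2 x / f2 x"
definition h :: "real ^ 3 \<Rightarrow> real" where "h x = (f2 x)\<^sup>2 * a x / (f1 x)\<^sup>2"
definition h' :: "real ^ 3 \<Rightarrow> real" where
  "h' x = (f2 x)\<^sup>2 / (f1 x)\<^sup>2 * (partial 2 a x + 2 * a x * b x - 2 * (a x)\<^sup>2)"

definition G :: "real ^ 3 \<Rightarrow> real ^ 3 \<Rightarrow> real ^ 3 \<Rightarrow> real ^ 3" where
  "G x v w = (- a x * (v $ 1 * w $ 2 + v $ 2 * w $ 1)) *\<^sub>R axis 1 1
    + (h x * (v $ 1 * w $ 1) - b x * (v $ 2 * w $ 2)) *\<^sub>R axis 2 1"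

definition G' :: "real ^ 3 \<Rightarrow> real ^ 3 \<Rightarrow> real ^ 3 \<Rightarrow> real ^ 3 \<Rightarrow> real ^ 3" where
  "G' x u v w = u $ 2 *\<^sub>R ((- partial 2 a x * (v $ 1 * w $ 2 + v $ 2 * w $ 1)) *\<^sub>R axis 1 1
    + (h' x * (v $ 1 * w $ 1) - partial 2 b x * (v $ 2 * w $ 2)) *\<^sub>R axis 2 1)"

lemma G_nth [simp]:
  "G x v w $ 1 = - a x * (v $ 1 * w $ 2 + v $ 2 * w $ 1)"
  "G x v w $ 2 = h x * (v $ 1 * w $ 1) - b x * (v $ 2 * w $ 2)"
  "G x v w $ 3 = 0"
  by (simp_all add: G_def axis_def)

lemma G'_nth [simp]:
  "G' x u v w $ 1 = - u $ 2 * (partial 2 a x * (v $ 1 * w $ 2 + v $ 2 * w $ 1))"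
  "G' x u v w $ 2 = u $ 2 * (h' x * (v $ 1 * w $ 1) - partial 2 b x * (v $ 2 * w $ 2))"
  "G' x u v w $ 3 = 0"
  by (simp_all add: G'_def axis_def)

section \<open>Derivatives of the coefficient functions\<close>

lemma smooth_ab: "smooth_on S a" "smooth_on S b"
  unfolding a_def[abs_def] b_def[abs_def]
  by (intro smooth_on_divide smooth_on_partial open_S smooth_f f_nz; assumption)+

lemma smooth_h: "smooth_on S h"
  unfolding h_def[abs_def] power2_eq_square
  by (intro smooth_on_divide smooth_on_mult open_S smooth_f smooth_ab) (simp add: f_nz)

text \<open>Writing the derivatives as \<open>a f1\<close> and \<open>b f2\<close> lets later
  quotients be differentiated in terms of \<open>a\<close> and \<open>b\<close>.\<close>

lemma f_deriv:
  assumes "x \<in> S"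
  shows "(f1 has_derivative (\<lambda>v. v $ 2 * (a x * f1 x))) (at x)"
    and "(f2 has_derivative (\<lambda>v. v $ 2 * (b x * f2 x))) (at x)"
  using second_coord_only_has_derivative[OF open_S assms smooth_f(1) f_second(1)]
    second_coord_only_has_derivative[OF open_S assms smooth_f(2) f_second(2)] f_nz[OF assms]
  by (simp_all add: a_def b_def)

text \<open>The quotient rule gives a derivative proportional to the second component of the
  direction.\<close>

lemma second_coord_only_log_deriv:
  assumes "smooth_on S f" "\<And>x. x \<in> S \<Longrightarrow> f x \<noteq> 0" "second_coord_only S f"
  shows "second_coord_only S (\<lambda>x. partial 2 f x / f x)"
proof -
  have "((\<lambda>x. partial 2 f x / f x) has_derivative
      (\<lambda>v. v $ 2 * ((partial 2 (partial 2 f) x * f x - (partial 2 f x)\<^sup>2) / (f x)\<^sup>2))) (at x)"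
    if "x \<in> S" for x
    using that assms
    by (auto intro!: derivative_eq_intros second_coord_only_has_derivative[OF open_S]
        second_coord_only_partial[OF open_S] smooth_on_partial
        simp: fun_eq_iff field_simps power2_eq_square)
  from partial_eqI[OF this] show ?thesis
    by (simp add: second_coord_only_def axis_def)
qed

lemma ab_deriv:
  assumes "x \<in> S"
  shows "(a has_derivative (\<lambda>v. v $ 2 * partial 2 a x)) (at x)"
    and "(b has_derivative (\<lambda>v. v $ 2 * partial 2 b x)) (at x)"
  using second_coord_only_log_deriv[OF smooth_f(1) f_nz(1) f_second(1)]
    second_coord_only_log_deriv[OF smooth_f(2) f_nz(2) f_second(2)]
  unfolding a_def[symmetric] b_def[symmetric]
  by (auto intro: second_coord_only_has_derivative[OF open_S assms] smooth_ab)

lemma h_deriv: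
  assumes "x \<in> S"
  shows "(h has_derivative (\<lambda>v. v $ 2 * h' x)) (at x)"
  unfolding h_def[abs_def] h'_def
  using f_nz[OF assms]
  by (auto intro!: derivative_eq_intros f_deriv[OF assms] ab_deriv[OF assms]
      simp: fun_eq_iff field_simps power2_eq_square)

lemma nth_deriv:
  assumes "x \<in> S" "smooth_on S X"
  shows "((\<lambda>y. X y $ i) has_derivative (\<lambda>v. frechet_derivative X (at x) v $ i)) (at x)"
  by (rule bounded_linear.has_derivative[OF bounded_linear_vec_nth
        smooth_on_has_derivative[OF open_S assms]])

sublocale christoffel S G G'
proof
  show "bilinear (G x)" for x
    unfolding bilinear_def
    by (auto intro!: linearI simp: G_def vec_eq_iff forall_3 axis_def algebra_simps)
  show "G x v w = G x w v" for x v w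
    by (simp add: G_def algebra_simps)
  show "smooth_on S (\<lambda>x. G x (X x) (Y x))" if "smooth_on S X" "smooth_on S Y" for X Y
    unfolding G_def
    by (intro smooth_on_add smooth_on_diff smooth_on_scaleR smooth_on_mult smooth_on_minus
        smooth_on_const smooth_on_nth open_S smooth_ab smooth_h that)
  show "((\<lambda>y. G y (X y) (Y y)) has_derivative
        (\<lambda>v. G' x v (X x) (Y x) + G x (frechet_derivative X (at x) v) (Y x)
          + G x (X x) (frechet_derivative Y (at x) v))) (at x)"
    if "smooth_on S X" "smooth_on S Y" "x \<in> S" for X Y x
    unfolding G_def
    by (rule derivative_eq_intros refl nth_deriv h_deriv ab_deriv that)+
       (simp add: fun_eq_iff G'_def vec_eq_iff forall_3 axis_def algebra_simps)
qed (rule open_S)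

section \<open>Compatibility with the metric and the Killing field\<close>

lemma metric_deriv:
  assumes "smooth_on S Y" "smooth_on S Z" "x \<in> S"
  shows "((\<lambda>y. g_tilde f1 f2 y (Y y) (Z y)) has_derivative
    (\<lambda>v. - 2 * v $ 2 * (a x / (f1 x)\<^sup>2 * (Y x $ 1 * Z x $ 1) + b x / (f2 x)\<^sup>2 * (Y x $ 2 * Z x $ 2))
      + g_tilde f1 f2 x (frechet_derivative Y (at x) v) (Z x)
      + g_tilde f1 f2 x (Y x) (frechet_derivative Z (at x) v))) (at x)"
proof -
  have *: "((\<lambda>y. 1 / (f y)\<^sup>2) has_derivative (\<lambda>v. - 2 * v $ 2 * (c / (f x)\<^sup>2))) (at x)"
    if "(f has_derivative (\<lambda>v. v $ 2 * (c * f x))) (at x)" "f x \<noteq> 0" for f c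
    by (rule derivative_eq_intros refl that)+
       (use that in \<open>auto simp: fun_eq_iff field_simps power2_eq_square\<close>)
  note 1 = *[OF f_deriv(1) f_nz(1)] *[OF f_deriv(2) f_nz(2)]
  show ?thesis
    unfolding g_tilde_def coord_form_def
    by (rule has_derivative_eq_rhs, (rule has_derivative_add has_derivative_mult nth_deriv 1 assms)+)
       (simp add: fun_eq_iff algebra_simps)
qed

lemma dir_deriv_metric:
  assumes "smooth_on S Y" "smooth_on S Z" "x \<in> S"
  shows "dir_deriv X (\<lambda>y. g_tilde f1 f2 y (Y y) (Z y)) x =
    - 2 * X x $ 2 * (a x / (f1 x)\<^sup>2 * (Y x $ 1 * Z x $ 1) + b x / (f2 x)\<^sup>2 * (Y x $ 2 * Z x $ 2))
      + g_tilde f1 f2 x (dir_deriv X Y x) (Z x)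
      + g_tilde f1 f2 x (Y x) (dir_deriv X Z x)"
  by (simp add: dir_deriv_def frechet_derivative_at[OF metric_deriv[OF assms], symmetric])

lemma is_levi_civita_conn: "is_levi_civita_on S (g_tilde f1 f2) conn"
  unfolding is_levi_civita_on_def
proof (intro conjI allI impI ballI affine_connection_conn torsion_free_conn)
  fix X Y Z :: "(real ^ 3) vector_field" and x
  assume "smooth_on S X" and Y: "smooth_on S Y" and Z: "smooth_on S Z" and x: "x \<in> S"
  show "dir_deriv X (\<lambda>y. g_tilde f1 f2 y (Y y) (Z y)) x
    = g_tilde f1 f2 x (conn X Y x) (Z x) + g_tilde f1 f2 x (Y x) (conn X Z x)"
  proof -
    \<comment> \<open>Naming the reciprocals makes the claim polynomial, as \<open>algebra\<close>
      requires.\<close>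
    define p q where "p = 1 / (f1 x)\<^sup>2" and "q = 1 / (f2 x)\<^sup>2"
    have ap: "a x / (f1 x)\<^sup>2 = a x * p" and bq: "b x / (f2 x)\<^sup>2 = b x * q"
      by (simp_all add: p_def q_def)
    \<comment> \<open>This relation cancels the terms containing the first component of
      \<open>X\<close>; those with the second component match the derivative of the metric
      coefficients.\<close>
    have "q * h x = p * a x"
      using f_nz[OF x] by (simp add: p_def q_def h_def)
    then show ?thesis
      unfolding dir_deriv_metric[OF Y Z x] ap bq
      unfolding g_tilde_def coord_form_def conn_def
        p_def[symmetric] q_def[symmetric] vector_add_component G_nth
      by algebra
  qed
qed

text \<open>The field is constant, so its brackets are plain directional derivatives and cancel the
  product-rule terms. What remains is the derivative of the metric coefficients along
  \<open>x\<^sup>3\<close>, which is zero.\<close>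

lemma lie_deriv_metric_x3:
  assumes "smooth_on S Y" "smooth_on S Z" "x \<in> S"
  shows "lie_deriv_metric (coord_field 3) (g_tilde f1 f2) Y Z x = 0"
proof -
  have "lie_bracket (coord_field 3) W x = dir_deriv (coord_field 3) W x" for W
    by (simp add: lie_bracket_def dir_deriv_def coord_field_def[abs_def])
  then show ?thesis
    unfolding lie_deriv_metric_def dir_deriv_metric[OF assms]
    by (simp add: coord_field_def axis_def)
qed

section \<open>The Ricci tensor\<close>

lemma smooth_frame: "smooth_on S (frame f1 f2 k)"
proof -
  consider "frame f1 f2 k = (\<lambda>x. f1 x *\<^sub>R axis 1 1)" | "frame f1 f2 k = (\<lambda>x. f2 x *\<^sub>R axis 2 1)"
    | "frame f1 f2 k = (\<lambda>x. axis 3 1)"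
    using exhaust_3[of k] by (auto simp: fun_eq_iff frame_def coord_field_def)
  then show ?thesis
    by cases (simp_all add: smooth_on_scaleR smooth_on_const open_S smooth_f)
qed

text \<open>This is \<open>- r'' / r\<close> for \<open>r = 1 / f1\<close>, the length of the first
  coordinate field up to sign, where the prime stands for \<open>f2\<close> times the second partial
  derivative, that is, differentiation by arc length up to orientation.\<close>

definition gauss_curvature :: "real ^ 3 \<Rightarrow> real" where
  "gauss_curvature x = (f2 x)\<^sup>2 * (partial 2 a x - (a x)\<^sup>2 + a x * b x)"

lemma ricci_metric:
  assumes Y: "smooth_on S Y" and Z: "smooth_on S Z" and x: "x \<in> S"
  shows "ricci S (g_tilde f1 f2) (frame f1 f2) Y Z x
    = gauss_curvature x * (Y x $ 1 * Z x $ 1 / (f1 x)\<^sup>2 + Y x $ 2 * Z x $ 2 / (f2 x)\<^sup>2)"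
proof -
  have "bilinear (g_tilde f1 f2 y)" for y
    unfolding bilinear_def
    by (auto intro!: linearI simp: g_tilde_def coord_form_def algebra_simps add_divide_distrib)
  moreover have "g_tilde f1 f2 y v w = g_tilde f1 f2 y w v" for y v w
    by (simp add: g_tilde_def mult.commute)
  moreover have "v = 0" if "y \<in> S" and v: "g_tilde f1 f2 y v v = 0" for y v
  proof -
    have "(v $ 1 / f1 y)\<^sup>2 + (v $ 2 / f2 y)\<^sup>2 + (v $ 3)\<^sup>2 = 0"
      using v by (simp add: g_tilde_def coord_form_def power2_eq_square)
    then have "v $ 1 / f1 y = 0 \<and> v $ 2 / f2 y = 0 \<and> v $ 3 = 0"
      by (simp add: add_nonneg_eq_0_iff del: divide_eq_0_iff power_divide)
    then show ?thesis using f_nz[OF \<open>y \<in> S\<close>] by (simp add: vec_eq_iff forall_3)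
  qed
  ultimately have curv: "curvature (levi_civita S (g_tilde f1 f2)) (frame f1 f2 k) Y Z x
      = curvature conn (frame f1 f2 k) Y Z x" for k
    by (intro curvature_levi_civita[OF is_levi_civita_conn _ _ _ smooth_frame Y Z x])
  define p q K M
    where "p = 1 / (f1 x)\<^sup>2" and "q = 1 / (f2 x)\<^sup>2" and "K = gauss_curvature x"
      and "M = partial 2 a x - (a x)\<^sup>2 + a x * b x"
  \<comment> \<open>In the trace \<open>E\<^sub>1\<close> contributes \<open>M\<close> times the
    product of the second components, \<open>E\<^sub>2\<close> contributes
    \<open>h' - b h + a h\<close> times the product of the first ones, and \<open>E\<^sub>3\<close>
    contributes nothing. These relations identify both factors with \<open>K\<close> times the
    metric coefficients.\<close>
  have K: "p * f1 x * f1 x = 1" "q * f2 x * f2 x = 1" "K * q = M"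
      "K * p = h' x - b x * h x + a x * h x"
    using f_nz[OF x]
    by (simp_all add: p_def q_def K_def M_def gauss_curvature_def h_def h'_def
        power2_eq_square field_simps)
  have p: "v / (f1 x)\<^sup>2 = v * p" and q: "v / (f2 x)\<^sup>2 = v * q" for v
    by (simp_all add: p_def q_def)
  have frame: "frame f1 f2 1 x $ 1 = f1 x" "frame f1 f2 1 x $ 2 = 0" "frame f1 f2 1 x $ 3 = 0"
      "frame f1 f2 2 x $ 1 = 0" "frame f1 f2 2 x $ 2 = f2 x" "frame f1 f2 2 x $ 3 = 0"
      "frame f1 f2 3 x $ 1 = 0" "frame f1 f2 3 x $ 2 = 0" "frame f1 f2 3 x $ 3 = 1"
    by (simp_all add: frame_def coord_field_def axis_def)
  show ?thesis
    unfolding ricci_def curv curvature_conn[OF smooth_frame Y Z x] sum_3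
    unfolding g_tilde_def coord_form_def vector_add_component vector_minus_component G_nth G'_nth frame
      p q K_def[symmetric]
    using K unfolding M_def by algebra
qed

section \<open>The soliton equation\<close>

lemma almost_eta_ricci_soliton_iff:
  assumes "smooth_on S lam" "smooth_on S mu" "\<exists>x\<in>S. mu x \<noteq> 0"
  shows "almost_eta_ricci_soliton S (g_tilde f1 f2) (frame f1 f2)
      (coord_field 3) (coord_form 3) lam mu \<longleftrightarrow>
    (\<forall>x\<in>S. lam x = - gauss_curvature x) \<and> (\<forall>x\<in>S. mu x = gauss_curvature x)"
    (is "?soliton \<longleftrightarrow> ?K")
proof -
  define T where "T Y Z x = 1 / 2 * lie_deriv_metric (coord_field 3) (g_tilde f1 f2) Y Z x
    + ricci S (g_tilde f1 f2) (frame f1 f2) Y Z x + lam x * g_tilde f1 f2 x (Y x) (Z x)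
    + mu x * (coord_form 3 x (Y x) * coord_form 3 x (Z x))" for Y Z x
  have T: "T Y Z x = (gauss_curvature x + lam x) *
        (Y x $ 1 * Z x $ 1 / (f1 x)\<^sup>2 + Y x $ 2 * Z x $ 2 / (f2 x)\<^sup>2)
      + (lam x + mu x) * (Y x $ 3 * Z x $ 3)"
    if "smooth_on S Y" "smooth_on S Z" "x \<in> S" for Y Z x
    unfolding T_def lie_deriv_metric_x3[OF that] ricci_metric[OF that]
    by (simp add: g_tilde_def coord_form_def algebra_simps add_divide_distrib)
  have "smooth_one_form_on S (coord_form 3)"
    by (auto simp: smooth_one_form_on_def coord_form_def intro!: linearI smooth_on_const open_S)
  moreover have const: "smooth_on S (coord_field i :: (real ^ 3) vector_field)" for i
    unfolding coord_field_def[abs_def] by (rule smooth_on_const[OF open_S])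
  ultimately have "?soliton \<longleftrightarrow>
      (\<forall>Y Z. smooth_on S Y \<longrightarrow> smooth_on S Z \<longrightarrow> (\<forall>x\<in>S. T Y Z x = 0))"
    using assms by (simp add: almost_eta_ricci_soliton_def T_def)
  also have "\<dots> \<longleftrightarrow> ?K"
  proof
    assume soliton: "\<forall>Y Z. smooth_on S Y \<longrightarrow> smooth_on S Z \<longrightarrow> (\<forall>x\<in>S. T Y Z x = 0)"
    have "gauss_curvature x + lam x = 0 \<and> lam x + mu x = 0" if "x \<in> S" for x
    proof
      \<comment> \<open>Constant coordinate fields suffice as test fields: the second one isolates
        the coefficient of the surface part, the third one that of the line part.\<close>
      have zero: "T (coord_field i) (coord_field i) x = 0" for i
        using soliton const that by blast
      show "gauss_curvature x + lam x = 0"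
        using T[OF const const that, of 2 2] zero[of 2] f_nz(2)[OF that]
        by (simp add: coord_field_def axis_def)
      show "lam x + mu x = 0"
        using T[OF const const that, of 3 3] zero[of 3] by (simp add: coord_field_def axis_def)
    qed
    then show ?K by (simp add: eq_neg_iff_add_eq_0 add.commute) (smt (verit))
  next
    assume ?K
    then show "\<forall>Y Z. smooth_on S Y \<longrightarrow> smooth_on S Z \<longrightarrow> (\<forall>x\<in>S. T Y Z x = 0)"
      by (simp add: T)
  qed
  finally show ?thesis .
qed

end

lemma open_box3: "open I1 \<Longrightarrow> open I2 \<Longrightarrow> open I3 \<Longrightarrow> open (box3 I1 I2 I3)"
  unfolding box3_def
  by (intro open_Collect_conj open_vimage[of _ "\<lambda>x. x $ _", unfolded vimage_def] continuous_intros)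

theorem theorem3p27:
  fixes I1 I2 I3 :: "real set" and I :: "(real ^ 3) set"
    and f1 f2 lam mu :: "real ^ 3 \<Rightarrow> real"
  assumes "open I1" "is_interval I1" "open I2" "is_interval I2" "open I3" "is_interval I3"
    and "I = box3 I1 I2 I3"
    and "smooth_on I f1" "smooth_on I f2"
    and "\<forall>x\<in>I. f1 x \<noteq> 0" "\<forall>x\<in>I. f2 x \<noteq> 0"
    and "smooth_on I lam" "smooth_on I mu" "\<exists>x\<in>I. mu x \<noteq> 0"
    and "\<forall>x\<in>I. \<forall>y\<in>I. x $ 2 = y $ 2 \<longrightarrow> f1 x = f1 y \<and> f2 x = f2 y"
  shows "almost_eta_ricci_soliton I (g_tilde f1 f2) (frame f1 f2)
           (coord_field 3) (coord_form 3) lam mu \<longleftrightarrow>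
         (\<forall>x\<in>I. lam x = - (f2 x)\<^sup>2 *
            (partial 2 (\<lambda>y. partial 2 f1 y / f1 y) x - (partial 2 f1 x / f1 x)\<^sup>2
             + partial 2 f1 x / f1 x * (partial 2 f2 x / f2 x))) \<and>
         (\<forall>x\<in>I. mu x = (f2 x)\<^sup>2 *
            (partial 2 (\<lambda>y. partial 2 f1 y / f1 y) x - (partial 2 f1 x / f1 x)\<^sup>2
             + partial 2 f1 x / f1 x * (partial 2 f2 x / f2 x)))"
proof -
  have "open I"
    using assms(1,3,5,7) open_box3 by simp
  have const: "f1 x = f1 y" "f2 x = f2 y" if "x \<in> I" "y \<in> I" "x $ 2 = y $ 2" for x y
    using assms(15) that by blast+
  interpret diagonal_metric I f1 f2
  proof
    show "open I" by fact
    show "smooth_on I f1" by (rule assms(8))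
    show "smooth_on I f2" by (rule assms(9))
    show "f1 x \<noteq> 0" if "x \<in> I" for x using assms(10) that by (rule bspec)
    show "f2 x \<noteq> 0" if "x \<in> I" for x using assms(11) that by (rule bspec)
    show "second_coord_only I f1"
      by (rule second_coord_only_if_const[OF \<open>open I\<close> assms(8)]) (rule const(1))
    show "second_coord_only I f2"
      by (rule second_coord_only_if_const[OF \<open>open I\<close> assms(9)]) (rule const(2))
  qed
  show ?thesis
    \<comment> \<open>\<open>a\<close> occurs unapplied under \<open>partial 2\<close>, so its
      definition is unfolded as a function.\<close>
    unfolding almost_eta_ricci_soliton_iff[OF assms(12-14)] gauss_curvature_def a_def[abs_def] b_def
    by simp
qed

end
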